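(* The poset $(\Omega/\!\equiv,\sqsubseteq)$ is equimorphic to $([\omega]^{<\omega},\subseteq)$, i.e. each of these posets order-embeds into the other.
   Context: $\mathbb{B}=\{0,1\}$; $\Omega$ is the set of all Boolean functions $f:\mathbb{B}^n\to\mathbb{B}$, $n\ge1$. For $n$-ary $f$ and $m$-ary $g$, $g\le f$ means $g=f(p_1,\dots,p_n)$ for some $m$-ary projections $p_1,\dots,p_n$ (maps $(a_1,\dots,a_m)\mapsto a_i$). $f\equiv g$ iff $f\le g$ and $g\le f$; $\Omega/\!\equiv$ is the set of equivalence classes, partially ordered by the induced order $\sqsubseteq$. $[\omega]^{<\omega}$ is the set of finite subsets of the natural numbers $\omega$. An embedding $e:P\to Q$ of posets satisfies $x\le y\iff e(x)\le e(y)$. *)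

theory Defs
  imports Main "HOL-Library.FuncSet"
begin

text \<open>Tuples over the two-element set are boolean lists, with coordinates numbered from 0.\<close>

definition cube :: "nat \<Rightarrow> bool list set" where
  "cube n = {a. length a = n}"

text \<open>
  A boolean function is stored together with its arity; the extensional function space makes the
  second component correspond exactly to a map defined on the cube, so that equality of pairs is
  equality of boolean functions.  The explicit arity is needed because an extensional constant
  function does not determine its domain.
\<close>

type_synonym boolfun = "nat \<times> (bool list \<Rightarrow> bool)"

definition Omega :: "boolfun set" where
  "Omega = (SIGMA n:{1..}. cube n \<rightarrow>\<^sub>E UNIV)"

definition projections :: "nat \<Rightarrow> (bool list \<Rightarrow> bool) set" where
  "projections m = {(\<lambda>a\<in>cube m. a ! i) | i. i < m}"

definition compose_fun :: "nat \<Rightarrow> (bool list \<Rightarrow> bool) \<Rightarrow> (bool list \<Rightarrow> bool) list \<Rightarrow> bool list \<Rightarrow> bool" where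
  "compose_fun m f ps = (\<lambda>a\<in>cube m. f (map (\<lambda>p. p a) ps))"

definition minor_le :: "boolfun \<Rightarrow> boolfun \<Rightarrow> bool" where
  "minor_le = (\<lambda>(m, g) (n, f).
     \<exists>ps. length ps = n \<and> set ps \<subseteq> projections m \<and> g = compose_fun m f ps)"

definition minor_equiv :: "(boolfun \<times> boolfun) set" where
  "minor_equiv = {(f, g) \<in> Omega \<times> Omega. minor_le f g \<and> minor_le g f}"

definition Omega_classes :: "boolfun set set" where
  "Omega_classes = Omega // minor_equiv"

definition class_le :: "boolfun set \<Rightarrow> boolfun set \<Rightarrow> bool" where
  "class_le X Y \<longleftrightarrow> (\<exists>f\<in>X. \<exists>g\<in>Y. minor_le f g)"

definition finite_nat_sets :: "nat set set" where
  "finite_nat_sets = {A. finite A}"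

definition order_embedding ::
  "'a set \<Rightarrow> ('a \<Rightarrow> 'a \<Rightarrow> bool) \<Rightarrow> 'b set \<Rightarrow> ('b \<Rightarrow> 'b \<Rightarrow> bool) \<Rightarrow> ('a \<Rightarrow> 'b) \<Rightarrow> bool" where
  "order_embedding P le Q le' e \<longleftrightarrow>
     e ` P \<subseteq> Q \<and> (\<forall>x\<in>P. \<forall>y\<in>P. le x y \<longleftrightarrow> le' (e x) (e y))"

definition equimorphic ::
  "'a set \<Rightarrow> ('a \<Rightarrow> 'a \<Rightarrow> bool) \<Rightarrow> 'b set \<Rightarrow> ('b \<Rightarrow> 'b \<Rightarrow> bool) \<Rightarrow> bool" where
  "equimorphic P le Q le' \<longleftrightarrow>
     (\<exists>e. order_embedding P le Q le' e) \<and> (\<exists>e. order_embedding Q le' P le e)"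

lemma minor_le_iff:
  "minor_le (m, g) (n, f) \<longleftrightarrow>
     (\<exists>\<pi>. (\<forall>i<n. \<pi> i < m) \<and> g = (\<lambda>a\<in>cube m. f (map (\<lambda>i. a ! \<pi> i) [0..<n])))"
proof
  assume "minor_le (m, g) (n, f)"
  then obtain ps where ps: "length ps = n" "set ps \<subseteq> projections m" "g = compose_fun m f ps"
    by (auto simp: minor_le_def)
  have "\<forall>i<n. \<exists>j<m. ps ! i = (\<lambda>a\<in>cube m. a ! j)"
    using ps(1,2) by (force simp: projections_def dest: nth_mem)
  then obtain \<pi> where \<pi>: "\<forall>i<n. \<pi> i < m \<and> ps ! i = (\<lambda>a\<in>cube m. a ! \<pi> i)"
    by metis
  have "map (\<lambda>p. p a) ps = map (\<lambda>i. a ! \<pi> i) [0..<n]" if "a \<in> cube m" for a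
    using that \<pi> ps(1) by (auto intro: nth_equalityI)
  then show "\<exists>\<pi>. (\<forall>i<n. \<pi> i < m) \<and> g = (\<lambda>a\<in>cube m. f (map (\<lambda>i. a ! \<pi> i) [0..<n]))"
    using \<pi> ps(3) by (intro exI[of _ \<pi>]) (auto simp: compose_fun_def intro!: restrict_ext)
next
  assume "\<exists>\<pi>. (\<forall>i<n. \<pi> i < m) \<and> g = (\<lambda>a\<in>cube m. f (map (\<lambda>i. a ! \<pi> i) [0..<n]))"
  then obtain \<pi> where \<pi>: "\<forall>i<n. \<pi> i < m"
    "g = (\<lambda>a\<in>cube m. f (map (\<lambda>i. a ! \<pi> i) [0..<n]))" by blast
  let ?ps = "map (\<lambda>i. \<lambda>a\<in>cube m. a ! \<pi> i) [0..<n]"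
  have "set ?ps \<subseteq> projections m"
    using \<pi>(1) by (auto simp: projections_def)
  moreover have "g = compose_fun m f ?ps"
    unfolding \<pi>(2) compose_fun_def by (rule restrict_ext) (simp add: comp_def)
  ultimately show "minor_le (m, g) (n, f)"
    by (auto simp: minor_le_def intro!: exI[of _ ?ps])
qed

lemma minor_le_refl: "f \<in> Omega \<Longrightarrow> minor_le f f"
proof -
  assume "f \<in> Omega"
  then obtain n h where f: "f = (n, h)" "h \<in> cube n \<rightarrow>\<^sub>E UNIV"
    by (auto simp: Omega_def)
  have "h = (\<lambda>a\<in>cube n. h (map (\<lambda>i. a ! i) [0..<n]))"
  proof
    fix a
    show "h a = (\<lambda>a\<in>cube n. h (map (\<lambda>i. a ! i) [0..<n])) a"
    proof (cases "a \<in> cube n")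
      case True
      then have "map (\<lambda>i. a ! i) [0..<n] = a" by (auto simp: cube_def map_nth)
      with True show ?thesis by simp
    qed (use f(2) in \<open>auto simp: PiE_def extensional_def\<close>)
  qed
  then show ?thesis
    unfolding f(1) minor_le_iff by (intro exI[of _ "\<lambda>i. i"]) simp
qed

lemma minor_le_trans: "minor_le f g \<Longrightarrow> minor_le g h \<Longrightarrow> minor_le f h"
proof -
  assume fg: "minor_le f g" and gh: "minor_le g h"
  obtain k f' m g' n h' where eq: "f = (k, f')" "g = (m, g')" "h = (n, h')"
    by (metis prod.exhaust)
  obtain \<pi> where \<pi>: "\<forall>i<m. \<pi> i < k" "f' = (\<lambda>a\<in>cube k. g' (map (\<lambda>i. a ! \<pi> i) [0..<m]))"
    using fg unfolding eq minor_le_iff by blast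
  obtain \<rho> where \<rho>: "\<forall>i<n. \<rho> i < m" "g' = (\<lambda>a\<in>cube m. h' (map (\<lambda>i. a ! \<rho> i) [0..<n]))"
    using gh unfolding eq minor_le_iff by blast
  have comp: "map (\<lambda>i. map (\<lambda>i. a ! \<pi> i) [0..<m] ! \<rho> i) [0..<n] = map (\<lambda>i. a ! \<pi> (\<rho> i)) [0..<n]"
    for a :: "bool list" using \<rho>(1) by simp
  have "f' = (\<lambda>a\<in>cube k. h' (map (\<lambda>i. a ! \<pi> (\<rho> i)) [0..<n]))"
    unfolding \<pi>(2) \<rho>(2) by (intro restrict_ext) (simp add: cube_def comp del: map_eq_conv)
  then show "minor_le f h"
    unfolding eq minor_le_iff using \<pi>(1) \<rho>(1) by (intro exI[of _ "\<lambda>i. \<pi> (\<rho> i)"]) simp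
qed

lemma equiv_minor_equiv: "equiv Omega minor_equiv"
proof (rule equivI)
  show "refl_on Omega minor_equiv"
    by (auto simp: refl_on_def minor_equiv_def minor_le_refl)
qed (auto simp: minor_equiv_def sym_def trans_def intro: minor_le_trans)

lemma class_le_iff:
  assumes "f \<in> Omega" "g \<in> Omega"
  shows "class_le (minor_equiv `` {f}) (minor_equiv `` {g}) \<longleftrightarrow> minor_le f g"
proof
  assume "class_le (minor_equiv `` {f}) (minor_equiv `` {g})"
  then show "minor_le f g"
    by (auto simp: class_le_def minor_equiv_def intro: minor_le_trans)
next
  assume "minor_le f g"
  moreover have "f \<in> minor_equiv `` {f}" "g \<in> minor_equiv `` {g}"
    using assms by (auto simp: minor_equiv_def minor_le_refl)
  ultimately show "class_le (minor_equiv `` {f}) (minor_equiv `` {g})"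
    unfolding class_le_def by blast
qed

lemma partial_order_class_le:
  "reflp_on Omega_classes class_le \<and> transp_on Omega_classes class_le \<and>
   antisymp_on Omega_classes class_le"
proof (intro conjI)
  show "reflp_on Omega_classes class_le"
    by (auto simp: reflp_on_def Omega_classes_def class_le_iff minor_le_refl elim!: quotientE)
  show "transp_on Omega_classes class_le"
    by (auto simp: transp_on_def Omega_classes_def class_le_iff
        elim!: quotientE intro: minor_le_trans)
  show "antisymp_on Omega_classes class_le"
  proof (rule antisymp_onI)
    fix X Y
    assume "X \<in> Omega_classes" "Y \<in> Omega_classes" and le: "class_le X Y" "class_le Y X"
    then obtain f g where fg: "f \<in> Omega" "X = minor_equiv `` {f}"
      "g \<in> Omega" "Y = minor_equiv `` {g}"
      by (auto simp: Omega_classes_def elim!: quotientE)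
    with le have "minor_le f g" "minor_le g f"
      by (simp_all only: class_le_iff)
    with fg have "(f, g) \<in> minor_equiv"
      by (simp add: minor_equiv_def)
    then show "X = Y"
      using fg equiv_class_eq[OF equiv_minor_equiv] by simp
  qed
qed

end

theory Submission
  imports Defs "HOL-Library.Countable_Set"
begin

text \<open>
  Every minor of an \<open>n\<close>-ary function is equivalent to an \<open>n\<close>-ary one, so principal down-sets of
  the countable poset of classes are finite; sending a class to the (coded) set of classes below
  it is an embedding into the finite sets of naturals.

  In the other direction, view a boolean function as a family of subsets of its coordinates, so
  that a minor along \<open>\<pi>\<close> pulls subsets back along \<open>\<pi>\<close>. Attach to \<open>k\<close> a block of coordinates whose
  size determines \<open>k\<close>, and to a finite set \<open>A\<close> the family consisting of the singletons in the
  blocks of \<open>A\<close> and of these blocks themselves, on the coordinates of the blocks and an extra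
  coordinate lying in no member of the family. Collapsing blocks to the extra coordinate shrinks
  \<open>A\<close>. Conversely the preimage of a block \<open>k\<close> is a member of the target family and is partitioned
  into several nonempty members, hence it is a block partitioned into singletons, of the same size.
\<close>

section \<open>Embedding the classes into the finite sets\<close>

lemma order_embedding_finite_downsets:
  assumes "countable P" "reflp_on P le" "transp_on P le"
    and fin: "\<And>x. x \<in> P \<Longrightarrow> finite {y \<in> P. le y x}"
  shows "order_embedding P le finite_nat_sets (\<subseteq>) (\<lambda>x. to_nat_on P ` {y \<in> P. le y x})"
  unfolding order_embedding_def
proof (intro conjI ballI)
  show "(\<lambda>x. to_nat_on P ` {y \<in> P. le y x}) ` P \<subseteq> finite_nat_sets"
    using fin by (auto simp: finite_nat_sets_def)
  fix x y assume xy: "x \<in> P" "y \<in> P"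
  have "to_nat_on P z \<in> to_nat_on P ` {z \<in> P. le z y} \<longleftrightarrow> z \<in> {z \<in> P. le z y}"
    if "z \<in> P" for z
    using inj_on_image_mem_iff[OF inj_on_to_nat_on[OF assms(1)] that] by simp
  then have "to_nat_on P ` {z \<in> P. le z x} \<subseteq> to_nat_on P ` {z \<in> P. le z y} \<longleftrightarrow>
      {z \<in> P. le z x} \<subseteq> {z \<in> P. le z y}"
    unfolding image_subset_iff by blast
  also have "\<dots> \<longleftrightarrow> le x y"
    using xy assms(2,3) by (auto dest: reflp_onD transp_onD)
  finally show "le x y \<longleftrightarrow>
      to_nat_on P ` {z \<in> P. le z x} \<subseteq> to_nat_on P ` {z \<in> P. le z y}" by simp
qed

lemma finite_cube: "finite (cube n)"
  using finite_lists_length_eq[of "UNIV :: bool set" n] by (simp add: cube_def)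

lemma finite_cube_funs: "finite (cube n \<rightarrow>\<^sub>E (UNIV :: bool set))"
  by (intro finite_PiE finite_cube) simp

lemma countable_Omega_classes: "countable Omega_classes"
proof -
  have "countable Omega"
    unfolding Omega_def
    by (intro countable_SIGMA countableI_type countable_finite finite_cube_funs)
  moreover have "Omega_classes = (\<lambda>f. minor_equiv `` {f}) ` Omega"
    by (auto simp: Omega_classes_def quotient_def)
  ultimately show ?thesis by (metis countable_image)
qed

text \<open>Only the at most \<open>n\<close> coordinates in the range of \<open>\<pi>\<close>
  matter for \<open>g\<close>. Moving them into \<open>{..<n}\<close> along a section of
  \<open>\<pi>\<close> keeps them distinct, so the change of arity can be undone.\<close>

lemma minor_equiv_same_arity:
  assumes "minor_le (m, g) (n, f)" "n \<ge> 1"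
  obtains h where "h \<in> cube n \<rightarrow>\<^sub>E UNIV" "minor_le (m, g) (n, h)" "minor_le (n, h) (m, g)"
proof -
  obtain \<pi> where \<pi>: "\<forall>i<n. \<pi> i < m" "g = (\<lambda>a\<in>cube m. f (map (\<lambda>i. a ! \<pi> i) [0..<n]))"
    using assms(1) unfolding minor_le_iff by blast
  \<comment> \<open>\<open>\<tau>\<close> is a section of \<open>\<pi>\<close> over its range, so \<open>\<tau> \<circ> \<pi>\<close> has the kernel of \<open>\<pi>\<close>.\<close>
  define \<tau> where "\<tau> j = (if j \<in> \<pi> ` {..<n} then inv_into {..<n} \<pi> j else 0)" for j
  have \<tau>: "\<pi> (\<tau> (\<pi> i)) = \<pi> i" "\<tau> (\<pi> i) < n" if "i < n" for i
    using that f_inv_into_f[of "\<pi> i" \<pi> "{..<n}"] inv_into_into[of "\<pi> i" \<pi> "{..<n}"]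
    by (auto simp: \<tau>_def)
  define h where "h = (\<lambda>a\<in>cube n. f (map (\<lambda>i. a ! \<tau> (\<pi> i)) [0..<n]))"
  show ?thesis
  proof
    show "h \<in> cube n \<rightarrow>\<^sub>E UNIV" by (simp add: h_def)
    have "map (\<lambda>i. map (\<lambda>i. a ! \<pi> i) [0..<n] ! \<tau> (\<pi> i)) [0..<n] = map (\<lambda>i. a ! \<pi> i) [0..<n]"
      for a :: "bool list" using \<tau> by simp
    then have "g = (\<lambda>a\<in>cube m. h (map (\<lambda>i. a ! \<pi> i) [0..<n]))"
      unfolding \<pi>(2) h_def by (intro restrict_ext) (simp add: cube_def del: map_eq_conv)
    with \<pi>(1) show "minor_le (m, g) (n, h)"
      unfolding minor_le_iff by blast
    show "minor_le (n, h) (m, g)"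
    proof -
      \<comment> \<open>The default value 0 of \<open>\<tau>\<close> is a legal coordinate because
        \<open>n \<ge> 1\<close>.\<close>
      have "\<tau> j < n" for j
        using \<tau>(2) assms(2) by (auto simp: \<tau>_def)
      have "map (\<lambda>i. map (\<lambda>i. a ! \<tau> i) [0..<m] ! \<pi> i) [0..<n] =
          map (\<lambda>i. a ! \<tau> (\<pi> i)) [0..<n]" for a :: "bool list" using \<pi>(1) by simp
      then have "h = (\<lambda>a\<in>cube n. g (map (\<lambda>i. a ! \<tau> i) [0..<m]))"
        unfolding \<pi>(2) h_def by (intro restrict_ext) (simp add: cube_def del: map_eq_conv)
      with \<open>\<And>j. \<tau> j < n\<close> show ?thesis
        unfolding minor_le_iff by (intro exI[of _ \<tau>] conjI allI impI)
    qed
  qed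
qed

text \<open>Each class below that of an \<open>n\<close>-ary function has a representative among the
  finitely many \<open>n\<close>-ary functions.\<close>

lemma finite_class_downset:
  assumes "X \<in> Omega_classes"
  shows "finite {Y \<in> Omega_classes. class_le Y X}"
proof -
  obtain F where "F \<in> Omega" and X: "X = minor_equiv `` {F}"
    using assms by (auto simp: Omega_classes_def elim!: quotientE)
  then obtain n f where F: "F = (n, f)" "n \<ge> 1" "f \<in> cube n \<rightarrow>\<^sub>E UNIV"
    by (auto simp: Omega_def)
  have "Y \<in> (\<lambda>h. minor_equiv `` {(n, h)}) ` (cube n \<rightarrow>\<^sub>E UNIV)"
    if Y: "Y \<in> Omega_classes" "class_le Y X" for Y
  proof -
    obtain G where G: "G \<in> Omega" "Y = minor_equiv `` {G}"
      using Y by (auto simp: Omega_classes_def elim!: quotientE)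
    obtain m g where mg: "G = (m, g)" by (cases G)
    have "minor_le (m, g) (n, f)"
      using Y class_le_iff[OF G(1) \<open>F \<in> Omega\<close>] G F X mg by simp
    with F(2) obtain h where h: "h \<in> cube n \<rightarrow>\<^sub>E UNIV" "minor_le (m, g) (n, h)" "minor_le (n, h) (m, g)"
      using minor_equiv_same_arity by blast
    with G mg F(2) have "(G, (n, h)) \<in> minor_equiv"
      by (auto simp: minor_equiv_def Omega_def)
    then have "Y = minor_equiv `` {(n, h)}"
      unfolding G(2) by (rule equiv_class_eq[OF equiv_minor_equiv])
    then show ?thesis using h(1) by (rule image_eqI)
  qed
  then have "{Y \<in> Omega_classes. class_le Y X} \<subseteq>
      (\<lambda>h. minor_equiv `` {(n, h)}) ` (cube n \<rightarrow>\<^sub>E UNIV)" by blast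
  then show ?thesis by (rule finite_subset) (intro finite_imageI finite_cube_funs)
qed

section \<open>Functions attached to sets of naturals\<close>

text \<open>Dyadic intervals are pairwise disjoint and have different sizes. Starting at 2 leaves 0
  free as the extra coordinate and gives even \<open>block 0\<close> two points, so no block is a
  singleton.\<close>

definition block :: "nat \<Rightarrow> nat set" where
  "block k = {2 ^ Suc k..<2 ^ Suc (Suc k)}"

definition edges :: "nat set \<Rightarrow> nat set set" where
  "edges A = (\<Union>k\<in>A. insert (block k) ((\<lambda>v. {v}) ` block k))"

definition vertices :: "nat set \<Rightarrow> nat set" where
  "vertices A = insert 0 (\<Union>k\<in>A. block k)"

text \<open>Coordinates outside \<^term>\<open>vertices A\<close> are inessential.\<close>

definition set_arity :: "nat set \<Rightarrow> nat" where
  "set_arity A = 2 ^ (\<Sum>A + 2)"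

definition set_fun :: "nat set \<Rightarrow> boolfun" where
  "set_fun A = (set_arity A,
     \<lambda>a\<in>cube (set_arity A). {i \<in> vertices A. a ! i} \<in> edges A)"

lemma card_block: "card (block k) = 2 ^ Suc k"
  by (simp add: block_def)

lemma zero_notin_block: "0 \<notin> block k"
  by (simp add: block_def)

lemma block_nonempty: "block k \<noteq> {}"
  using card_block[of k] by force

lemma block_disjoint:
  assumes "v \<in> block k" "v \<in> block l"
  shows "k = l"
proof -
  have "(2::nat) ^ Suc k < 2 ^ Suc (Suc l)" "(2::nat) ^ Suc l < 2 ^ Suc (Suc k)"
    using assms unfolding block_def by auto
  then have "Suc k < Suc (Suc l)" "Suc l < Suc (Suc k)"
    by (simp_all only: power_strict_increasing_iff one_less_numeral_iff semiring_norm)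
  then show ?thesis by simp
qed

lemma vertices_less_arity:
  assumes "finite A" "v \<in> vertices A"
  shows "v < set_arity A"
proof (cases "v = 0")
  case False
  then obtain k where k: "k \<in> A" "v \<in> block k"
    using assms by (auto simp: vertices_def)
  \<comment> \<open>The sum serves as an upper bound for the elements that also makes sense for the
    empty set.\<close>
  have "k \<le> \<Sum>A" using member_le_sum[of k A id] k(1) assms(1) by simp
  then have "(2::nat) ^ Suc (Suc k) \<le> set_arity A"
    unfolding set_arity_def by (intro power_increasing) auto
  then show ?thesis using k(2) by (simp add: block_def)
qed (simp add: set_arity_def)

lemma set_fun_in_Omega: "set_fun A \<in> Omega"
  by (simp add: set_fun_def Omega_def set_arity_def)

lemma edge_nonempty: "E \<in> edges A \<Longrightarrow> E \<noteq> {}"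
  using block_nonempty by (auto simp: edges_def)

lemma edge_subset: "E \<in> edges A \<Longrightarrow> E \<subseteq> (\<Union>k\<in>A. block k)"
  by (auto simp: edges_def)

text \<open>Every edge is nonempty and lies in one block. As blocks are disjoint, an edge covered by
  the blocks of \<open>A\<close> has its index in \<open>A\<close>.\<close>

lemma edges_restrict:
  assumes "A \<subseteq> B" "E \<subseteq> (\<Union>k\<in>A. block k)"
  shows "E \<in> edges B \<longleftrightarrow> E \<in> edges A"
proof
  assume "E \<in> edges B"
  then obtain k where k: "k \<in> B" "E \<in> insert (block k) ((\<lambda>v. {v}) ` block k)"
    by (auto simp: edges_def)
  then obtain v where "v \<in> E" "v \<in> block k"
    using block_nonempty[of k] by auto
  with assms(2) have "k \<in> A" using block_disjoint by blast
  with k(2) show "E \<in> edges A" by (auto simp: edges_def)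
qed (use assms(1) in \<open>auto simp: edges_def\<close>)

section \<open>Minors between these functions\<close>

text \<open>Tuples are read as characteristic functions of sets \<open>S\<close>, and substituting
  along \<open>\<pi>\<close> takes preimages. Letting \<open>S\<close> range over all sets is
  harmless, since only its members below \<open>set_arity A\<close> are tested.\<close>

lemma minor_le_set_fun_iff:
  assumes "finite A" "finite B"
  shows "minor_le (set_fun A) (set_fun B) \<longleftrightarrow>
    (\<exists>\<pi>. (\<forall>i<set_arity B. \<pi> i < set_arity A) \<and>
      (\<forall>S. S \<inter> vertices A \<in> edges A \<longleftrightarrow> {i \<in> vertices B. \<pi> i \<in> S} \<in> edges B))"
    (is "_ \<longleftrightarrow> (\<exists>\<pi>. ?R \<pi> \<and> ?Q \<pi>)")
proof -
  have minor_iff: "snd (set_fun A) = (\<lambda>a\<in>cube (set_arity A). snd (set_fun B)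
      (map (\<lambda>i. a ! \<pi> i) [0..<set_arity B])) \<longleftrightarrow> ?Q \<pi>" (is "?L \<longleftrightarrow> _")
    if \<pi>: "?R \<pi>" for \<pi>
  proof -
    have pull: "{i \<in> vertices B. map (\<lambda>i. a ! \<pi> i) [0..<set_arity B] ! i} =
        {i \<in> vertices B. a ! \<pi> i}" for a :: "bool list"
      using vertices_less_arity[OF assms(2)] by auto
    have "?L \<longleftrightarrow> (\<forall>a\<in>cube (set_arity A).
        {i \<in> vertices A. a ! i} \<in> edges A \<longleftrightarrow> {i \<in> vertices B. a ! \<pi> i} \<in> edges B)"
      by (auto simp: set_fun_def fun_eq_iff restrict_def pull cube_def)
    also have "\<dots> \<longleftrightarrow> ?Q \<pi>"
    proof (rule iffI; intro allI ballI)
      fix S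
      assume *: "\<forall>a\<in>cube (set_arity A).
        {i \<in> vertices A. a ! i} \<in> edges A \<longleftrightarrow> {i \<in> vertices B. a ! \<pi> i} \<in> edges B"
      let ?a = "map (\<lambda>i. i \<in> S) [0..<set_arity A]"
      have "{i \<in> vertices A. ?a ! i} = S \<inter> vertices A"
        using vertices_less_arity[OF assms(1)] by auto
      moreover have "{i \<in> vertices B. ?a ! \<pi> i} = {i \<in> vertices B. \<pi> i \<in> S}"
        using vertices_less_arity[OF assms(2)] \<pi> by auto
      moreover have "?a \<in> cube (set_arity A)" by (simp add: cube_def)
      ultimately show "S \<inter> vertices A \<in> edges A \<longleftrightarrow> {i \<in> vertices B. \<pi> i \<in> S} \<in> edges B"
        using bspec[OF *, of ?a] by simp
    next
      fix a assume "?Q \<pi>"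
      from spec[OF this, of "{i. a ! i}"]
      show "{i \<in> vertices A. a ! i} \<in> edges A \<longleftrightarrow> {i \<in> vertices B. a ! \<pi> i} \<in> edges B"
        by (simp add: Int_def conj_commute)
    qed
    finally show ?thesis .
  qed
  have pair: "(set_arity C, snd (set_fun C)) = set_fun C" for C
    by (simp add: set_fun_def)
  show ?thesis
    using minor_le_iff[of "set_arity A" "snd (set_fun A)" "set_arity B" "snd (set_fun B)"]
    unfolding pair using minor_iff by (simp cong: conj_cong)
qed

lemma set_fun_mono:
  assumes "A \<subseteq> B" "finite B"
  shows "minor_le (set_fun A) (set_fun B)"
proof -
  define \<pi> where "\<pi> i = (if i \<in> vertices A then i else 0)" for i
  have finA: "finite A" using assms finite_subset by blast
  have "\<pi> i < set_arity A" for i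
    using vertices_less_arity[OF finA] by (auto simp: \<pi>_def set_arity_def)
  moreover have "S \<inter> vertices A \<in> edges A \<longleftrightarrow> {i \<in> vertices B. \<pi> i \<in> S} \<in> edges B" for S
  proof (cases "0 \<in> S")
    \<comment> \<open>Both sides fail: \<open>\<pi>\<close> fixes 0, and no edge contains 0.\<close>
    case True
    then have "0 \<in> S \<inter> vertices A" "0 \<in> {i \<in> vertices B. \<pi> i \<in> S}"
      by (auto simp: vertices_def \<pi>_def)
    then show ?thesis using edge_subset zero_notin_block by blast
  next
    case False
    then have "{i \<in> vertices B. \<pi> i \<in> S} = S \<inter> vertices A"
      using assms(1) by (auto simp: \<pi>_def vertices_def intro!: gr0I)
    moreover have "S \<inter> vertices A \<subseteq> (\<Union>k\<in>A. block k)"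
      using False by (auto simp: vertices_def)
    ultimately show ?thesis using edges_restrict[OF assms(1)] by simp
  qed
  ultimately show ?thesis
    unfolding minor_le_set_fun_iff[OF finA assms(2)] by blast
qed

lemma set_fun_reflect:
  assumes "finite A" "finite B" "minor_le (set_fun A) (set_fun B)"
  shows "A \<subseteq> B"
proof
  fix k assume k: "k \<in> A"
  obtain \<pi> where
    \<pi>: "\<And>S. S \<inter> vertices A \<in> edges A \<longleftrightarrow> {i \<in> vertices B. \<pi> i \<in> S} \<in> edges B"
    using assms(3) unfolding minor_le_set_fun_iff[OF assms(1,2)] by blast
  define P where "P S = {i \<in> vertices B. \<pi> i \<in> S}" for S
  have P_edge: "P S \<in> edges B" if "S \<in> insert (block k) ((\<lambda>v. {v}) ` block k)" for S
  proof -
    have "S \<in> edges A" using that k by (auto simp: edges_def)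
    moreover from this have "S \<inter> vertices A = S"
      using edge_subset by (auto simp: vertices_def)
    ultimately show ?thesis using \<pi>[of S] by (simp add: P_def)
  qed
  have "(1::nat) < 2 ^ Suc k" by (rule one_less_power) auto
  then have "2 ^ Suc k \<in> block k" "2 ^ Suc k + 1 \<in> block k"
    by (auto simp: block_def)
  then obtain v w where vw: "v \<in> block k" "w \<in> block k" "v \<noteq> w"
    using n_not_Suc_n[of "2 ^ Suc k"] unfolding Suc_eq_plus1 by blast
  \<comment> \<open>Two disjoint nonempty parts keep the preimage of the block from being a singleton.\<close>
  have "P (block k) \<noteq> {x}" for x
  proof
    assume x: "P (block k) = {x}"
    have "P {v} \<noteq> {}" "P {w} \<noteq> {}"
      using P_edge vw edge_nonempty by (blast, blast)
    then obtain i j where "i \<in> P {v}" "j \<in> P {w}" by blast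
    then have "i \<in> P (block k)" "j \<in> P (block k)" "\<pi> i \<noteq> \<pi> j"
      using vw by (auto simp: P_def)
    then show False unfolding x by simp
  qed
  \<comment> \<open>An edge is a singleton or a block, so this preimage is a block.\<close>
  then obtain l where l: "l \<in> B" "P (block k) = block l"
    using P_edge[of "block k"] by (auto simp: edges_def)
  have single: "\<exists>x. P {u} = {x}" if u: "u \<in> block k" for u
  proof -
    obtain u' where u': "u' \<in> block k" "u' \<noteq> u" using vw by metis
    have "P {u'} \<noteq> {}" using P_edge u' edge_nonempty by blast
    then have proper: "P {u} \<noteq> P (block k)" using u' by (auto simp: P_def)
    have sub: "P {u} \<subseteq> block l" using u unfolding l(2)[symmetric] by (auto simp: P_def)
    have edge: "P {u} \<in> edges B" using P_edge u by blast
    \<comment> \<open>Inside \<open>block l\<close> the only edges are singletons and the block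
      itself, and \<open>proper\<close> rules out the latter.\<close>
    then have "P {u} \<in> edges {l}"
      using edges_restrict[of "{l}" B "P {u}"] l(1) sub by simp
    with proper l(2) show ?thesis by (auto simp: edges_def)
  qed
  then have card_single: "card (P {u}) = 1" if "u \<in> block k" for u
    using that by force
  \<comment> \<open>The fibres over the points of \<open>block k\<close> partition
    \<open>block l\<close> into singletons, so counting them compares the two sizes, which determine
    the indices.\<close>
  have "block l = (\<Union>u\<in>block k. P {u})"
    unfolding l(2)[symmetric] by (auto simp: P_def)
  moreover have "card (\<Union>u\<in>block k. P {u}) = (\<Sum>u\<in>block k. card (P {u}))"
  proof (rule card_UN_disjoint)
    show "\<forall>u\<in>block k. finite (P {u})" using single by (metis finite.simps)
  qed (auto simp: P_def block_def)
  ultimately have "card (block l) = card (block k)"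
    using card_single by simp
  then have "l = k" by (simp add: card_block)
  with l(1) show "k \<in> B" by simp
qed

theorem mainTheorem4:
  shows "equimorphic Omega_classes class_le finite_nat_sets (\<subseteq>)"
  unfolding equimorphic_def
proof
  have "order_embedding Omega_classes class_le finite_nat_sets (\<subseteq>)
      (\<lambda>X. to_nat_on Omega_classes ` {Y \<in> Omega_classes. class_le Y X})"
    using partial_order_class_le finite_class_downset countable_Omega_classes
    by (intro order_embedding_finite_downsets) auto
  then show "\<exists>e. order_embedding Omega_classes class_le finite_nat_sets (\<subseteq>) e" by blast
next
  have "order_embedding finite_nat_sets (\<subseteq>) Omega_classes class_le
      (\<lambda>A. minor_equiv `` {set_fun A})"
    unfolding order_embedding_def
  proof (intro conjI ballI)
    show "(\<lambda>A. minor_equiv `` {set_fun A}) ` finite_nat_sets \<subseteq> Omega_classes"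
      by (auto simp: Omega_classes_def intro!: quotientI set_fun_in_Omega)
    fix A B assume "A \<in> finite_nat_sets" "B \<in> finite_nat_sets"
    then show "A \<subseteq> B \<longleftrightarrow>
        class_le (minor_equiv `` {set_fun A}) (minor_equiv `` {set_fun B})"
      using set_fun_mono set_fun_reflect
      unfolding finite_nat_sets_def class_le_iff[OF set_fun_in_Omega set_fun_in_Omega] by blast
  qed
  then show "\<exists>e. order_embedding finite_nat_sets (\<subseteq>) Omega_classes class_le e" by blast
qed

end
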